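(* Let $G$ be a finite simple graph, let $r \geq 1$ and let $k$ be a nonnegative integer. (i) If $\gamma_r(G) > 2k$, then $\tilde{H}_{j}(\mathrm{Ind}_r(G)) = 0$ for all $j \leq k+r-2$. (ii) If $\omega_r(G) > 2k$, then $\tilde{H}_{j}(\mathrm{Ind}_r(G)) = 0$ for all $j \leq k-1$.
   Context: For $r\ge 1$, a set $A\subseteq V(G)$ is $r$-independent if every connected component of the induced subgraph $G[A]$ has at most $r$ vertices. The $r$-independence complex $\mathrm{Ind}_r(G)$ is the simplicial complex on $V(G)$ whose simplices are the $r$-independent sets. $\tilde{H}_j$ denotes reduced homology with integer coefficients. For $D\subseteq V(G)$ and a vertex $u$, $d(u,D)=\min_{x\in D} d(u,x)$ (graph distance). A set $D\subseteq V(G)$ is a distance $r$-dominating set if $d(u,D)\le r$ for every $u\in V(G)\setminus D$; the distance $r$-domination number $\gamma_r(G)$ is the minimum size of such a set. A dominating $r$-collection is a collection $S_r$ of connected subgraphs of $G$, each with at most $r$ vertices, such that for every $v\in V(G)$ there is $S\in S_r$ with $d(v,S)\le 1$ (distance to the vertex set of $S$, which is $0$ if $v\in S$); the $r$-set domination number $\omega_r(G)$ is the minimum cardinality of a dominating $r$-collection. *)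

theory Defs
  imports
    "HOL-Algebra.Free_Abelian_Groups"
    "HOL-Algebra.Elementary_Groups"
    "Graph_Theory.Graph_Theory"
begin

section \<open>Reduced simplicial homology with integer coefficients\<close>

text \<open>
  An abstract simplicial complex is given by its set of simplices, the empty simplex included.
  The chain complex is the augmented oriented one, generated in degree \<^term>\<open>p\<close> by the simplices
  with \<^term>\<open>p + 1\<close> vertices; degree \<open>-1\<close> is generated by the empty simplex, and the chain groups
  in degrees below \<open>-1\<close> are trivial. Each simplex is oriented by one fixed total order of the
  vertex type; the choice does not affect the homology up to isomorphism.
\<close>

definition vertex_order :: "'a rel" where
  "vertex_order = (SOME R. linear_order R)"

lemma linear_order_vertex_order: "linear_order (vertex_order :: 'a rel)"
proof -
  obtain R :: "'a rel" where "well_order R"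
    using well_order_on[of UNIV] by blast
  then have "linear_order R"
    by (simp add: well_order_on_def)
  then show ?thesis
    unfolding vertex_order_def by (rule someI)
qed

definition simplicial_chain_group :: "'a set set \<Rightarrow> int \<Rightarrow> ('a set \<Rightarrow>\<^sub>0 int) monoid" where
  "simplicial_chain_group K p = free_Abelian_group {\<sigma> \<in> K. finite \<sigma> \<and> int (card \<sigma>) = p + 1}"

text \<open>If \<open>v\<^sub>0 < \<dots> < v\<^sub>p\<close> are the vertices of \<open>\<sigma>\<close>, then \<open>face_sign \<sigma> v\<^sub>i = (-1)^i\<close>.\<close>

definition face_sign :: "'a set \<Rightarrow> 'a \<Rightarrow> int" where
  "face_sign \<sigma> v = (- 1) ^ card {u \<in> \<sigma>. u \<noteq> v \<and> (u, v) \<in> vertex_order}"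

definition simplicial_boundary :: "('a set \<Rightarrow>\<^sub>0 int) \<Rightarrow> ('a set \<Rightarrow>\<^sub>0 int)" where
  "simplicial_boundary =
     frag_extend (\<lambda>\<sigma>. \<Sum>v\<in>\<sigma>. frag_cmul (face_sign \<sigma> v) (frag_of (\<sigma> - {v})))"

lemma face_sign_swap:
  assumes "finite \<sigma>" "v \<in> \<sigma>" "w \<in> \<sigma>" "v \<noteq> w"
  shows "face_sign \<sigma> w * face_sign (\<sigma> - {w}) v = - (face_sign \<sigma> v * face_sign (\<sigma> - {v}) w)"
proof -
  have tot: "(v, w) \<in> vertex_order \<longleftrightarrow> (w, v) \<notin> vertex_order"
  proof -
    have "antisym (vertex_order :: 'a rel)" and "total (vertex_order :: 'a rel)"
      using linear_order_vertex_order by (auto simp: linear_order_on_def partial_order_on_def)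
    then show ?thesis
      using assms(4) by (metis UNIV_I antisymD total_on_def)
  qed
  have del: "face_sign (\<tau> - {y}) x = (if (y, x) \<in> vertex_order then - 1 else 1) * face_sign \<tau> x"
    if "finite \<tau>" "y \<in> \<tau>" "x \<noteq> y" for \<tau> :: "'a set" and x y
  proof (cases "(y, x) \<in> vertex_order")
    case True
    have "{u \<in> \<tau>. u \<noteq> x \<and> (u, x) \<in> vertex_order}
        = insert y {u \<in> \<tau> - {y}. u \<noteq> x \<and> (u, x) \<in> vertex_order}"
      using that True by auto
    then have "card {u \<in> \<tau>. u \<noteq> x \<and> (u, x) \<in> vertex_order}
        = Suc (card {u \<in> \<tau> - {y}. u \<noteq> x \<and> (u, x) \<in> vertex_order})"
      using that(1) by simp
    then show ?thesis
      using True by (simp add: face_sign_def)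
  next
    case False
    then have "{u \<in> \<tau> - {y}. u \<noteq> x \<and> (u, x) \<in> vertex_order}
        = {u \<in> \<tau>. u \<noteq> x \<and> (u, x) \<in> vertex_order}"
      by auto
    then show ?thesis
      using False by (simp add: face_sign_def)
  qed
  show ?thesis
    unfolding del[OF assms(1,3,4)] del[OF assms(1,2) assms(4)[symmetric]]
    using tot by (cases "(v, w) \<in> vertex_order") simp_all
qed

lemma simplicial_boundary_boundary:
  assumes "\<And>\<sigma>. \<sigma> \<in> Poly_Mapping.keys c \<Longrightarrow> finite \<sigma>"
  shows "simplicial_boundary (simplicial_boundary c) = 0"
proof -
  have single: "simplicial_boundary (simplicial_boundary (frag_of \<sigma>)) = 0"
    if fin: "finite \<sigma>" for \<sigma> :: "'a set"
  proof -
    define P where "P = Sigma \<sigma> (\<lambda>v. \<sigma> - {v})"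
    define g where "g = (\<lambda>(v, w). frag_cmul (face_sign \<sigma> v * face_sign (\<sigma> - {v}) w)
                             (frag_of (\<sigma> - {v} - {w})))"
    have "simplicial_boundary (simplicial_boundary (frag_of \<sigma>))
        = (\<Sum>v\<in>\<sigma>. \<Sum>w\<in>\<sigma> - {v}. g (v, w))"
      by (simp add: simplicial_boundary_def frag_extend_sum[OF fin] frag_extend_cmul
          frag_cmul_sum g_def o_def)
    also have "\<dots> = sum g P"
      unfolding P_def by (subst sum.Sigma) (use fin in auto)
    finally have eq: "simplicial_boundary (simplicial_boundary (frag_of \<sigma>)) = sum g P" .
    have "sum g P = sum (g \<circ> prod.swap) P"
      by (rule sum.reindex_bij_witness[where i = prod.swap and j = prod.swap]) (auto simp: P_def)
    also have "\<dots> = (\<Sum>x\<in>P. - g x)"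
    proof (rule sum.cong)
      fix x assume "x \<in> P"
      then obtain v w where x: "x = (v, w)" "v \<in> \<sigma>" "w \<in> \<sigma>" "v \<noteq> w"
        by (auto simp: P_def)
      have "\<sigma> - {w} - {v} = \<sigma> - {v} - {w}" by auto
      then show "(g \<circ> prod.swap) x = - g x"
        using face_sign_swap[OF fin x(2-4)] by (simp add: g_def x(1))
    qed simp
    also have "\<dots> = - sum g P"
      by (rule sum_negf)
    finally have "sum g P = - sum g P" .
    then have "Poly_Mapping.lookup (sum g P) k = Poly_Mapping.lookup (- sum g P) k" for k
      by (rule arg_cong)
    then have "Poly_Mapping.lookup (sum g P) k = 0" for k
      unfolding lookup_uminus by (simp only: equal_neg_zero)
    then have "sum g P = 0"
      by (intro poly_mapping_eqI) simp
    then show ?thesis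
      using eq by simp
  qed
  have "Poly_Mapping.keys c \<subseteq> {\<sigma>. finite \<sigma>}"
    using assms by blast
  then show ?thesis
  proof (induction c rule: frag_induction)
    case zero
    show ?case by (simp add: simplicial_boundary_def)
  next
    case (one x)
    then show ?case by (simp add: single)
  next
    case (diff a b)
    then show ?case by (simp add: simplicial_boundary_def frag_extend_diff)
  qed
qed

definition simplicial_cycles :: "'a set set \<Rightarrow> int \<Rightarrow> ('a set \<Rightarrow>\<^sub>0 int) set" where
  "simplicial_cycles K p =
     {c \<in> carrier (simplicial_chain_group K p). simplicial_boundary c = 0}"

definition simplicial_boundaries :: "'a set set \<Rightarrow> int \<Rightarrow> ('a set \<Rightarrow>\<^sub>0 int) set" where
  "simplicial_boundaries K p = simplicial_boundary ` carrier (simplicial_chain_group K (p + 1))"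

definition reduced_simplicial_homology_group ::
    "'a set set \<Rightarrow> int \<Rightarrow> ('a set \<Rightarrow>\<^sub>0 int) set monoid" where
  "reduced_simplicial_homology_group K p =
     subgroup_generated (simplicial_chain_group K p) (simplicial_cycles K p)
       Mod simplicial_boundaries K p"


section \<open>Graphs\<close>

text \<open>
  A finite simple graph is a \<^locale>\<open>graph\<close>, that is, a finite symmetric loop-free digraph
  without parallel arcs. In a symmetric digraph the strongly connected components are
  the connected components of the graph.
\<close>

definition r_independent :: "('a, 'b) pre_digraph \<Rightarrow> nat \<Rightarrow> 'a set \<Rightarrow> bool" where
  "r_independent G r A \<longleftrightarrow>
     A \<subseteq> verts G \<and> (\<forall>C \<in> pre_digraph.sccs (G \<restriction> A). card (verts C) \<le> r)"

definition Ind_complex :: "('a, 'b) pre_digraph \<Rightarrow> nat \<Rightarrow> 'a set set" where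
  "Ind_complex G r = {A. r_independent G r A}"

text \<open>The distance between vertices in different components, or to an empty set, is \<open>\<infinity>\<close>.\<close>

definition graph_dist :: "('a, 'b) pre_digraph \<Rightarrow> 'a \<Rightarrow> 'a \<Rightarrow> ereal" where
  "graph_dist G u v = wf_digraph.\<mu> G (\<lambda>_. 1) u v"

definition graph_setdist :: "('a, 'b) pre_digraph \<Rightarrow> 'a \<Rightarrow> 'a set \<Rightarrow> ereal" where
  "graph_setdist G u D = (INF x\<in>D. graph_dist G u x)"

definition distance_dominating :: "('a, 'b) pre_digraph \<Rightarrow> nat \<Rightarrow> 'a set \<Rightarrow> bool" where
  "distance_dominating G r D \<longleftrightarrow>
     D \<subseteq> verts G \<and> (\<forall>u \<in> verts G - D. graph_setdist G u D \<le> ereal (real r))"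

definition distance_domination_number :: "('a, 'b) pre_digraph \<Rightarrow> nat \<Rightarrow> nat" where
  "distance_domination_number G r = (LEAST n. \<exists>D. distance_dominating G r D \<and> card D = n)"

text \<open>
  Subgraphs need not be induced. The condition \<open>symmetric S\<close> makes the subdigraph \<open>S\<close>
  an undirected subgraph.
\<close>

definition dominating_collection ::
    "('a, 'b) pre_digraph \<Rightarrow> nat \<Rightarrow> ('a, 'b) pre_digraph set \<Rightarrow> bool" where
  "dominating_collection G r \<S> \<longleftrightarrow>
     (\<forall>S \<in> \<S>. subgraph S G \<and> symmetric S \<and> Digraph_Component.connected S \<and> card (verts S) \<le> r) \<and>
     (\<forall>v \<in> verts G. \<exists>S \<in> \<S>. graph_setdist G v (verts S) \<le> 1)"

definition set_domination_number :: "('a, 'b) pre_digraph \<Rightarrow> nat \<Rightarrow> nat" where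
  "set_domination_number G r =
     (LEAST n. \<exists>\<S>. finite \<S> \<and> dominating_collection G r \<S> \<and> card \<S> = n)"

end

theory Submission
  imports Defs
begin

text \<open>
  \<open>Ind\<^sub>r(G)\<close> is the independence complex of the hypergraph \<open>H\<close> of connected \<open>(r + 1)\<close>-sets. Deleting
  an edge \<open>e\<close> from a hypergraph enlarges the independence complex by the simplices containing \<open>e\<close>,
  and modulo the old complex these form the \<open>|e|\<close>-fold suspension of the link of \<open>e\<close>, which is the
  independence complex of the contraction \<open>{f - e | f \<noteq> e}\<close>. So homology in degree \<open>j\<close> survives
  either the deletion of \<open>e\<close>, or the contraction of \<open>e\<close> with a shift to degree \<open>j - |e| + 1\<close>.
  Contracting at most \<open>k\<close> edges exhausts a class of degree at most \<open>k + r - 2\<close>, because the first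
  contraction costs \<open>r\<close> degrees and each later one at least one. The process ends with every vertex
  contracted or blocked by a one-vertex edge, that is, with a set of at most \<open>k\<close> connected
  \<open>(r + 1)\<close>-sets whose closed neighbourhood is everything. Splitting off a non-cut vertex from each
  yields a dominating \<open>r\<close>-collection with at most \<open>2k\<close> members, and one vertex from each member
  yields a distance \<open>r\<close>-dominating set; both (i) and (ii) follow.
\<close>

section \<open>Exactness of the simplicial chain complex\<close>

text \<open>Indexed by the number of vertices, so that \<open>exact_at K n\<close> concerns homology in degree \<open>n - 1\<close>.\<close>

definition faces :: "'a set set \<Rightarrow> nat \<Rightarrow> 'a set set" where
  "faces K n = {\<sigma> \<in> K. finite \<sigma> \<and> card \<sigma> = n}"

definition exact_at :: "'a set set \<Rightarrow> nat \<Rightarrow> bool" where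
  "exact_at K n \<longleftrightarrow>
     (\<forall>c. Poly_Mapping.keys c \<subseteq> faces K n \<and> simplicial_boundary c = 0 \<longrightarrow>
        (\<exists>d. Poly_Mapping.keys d \<subseteq> faces K (Suc n) \<and> simplicial_boundary d = c))"

definition down_closed :: "'a set set \<Rightarrow> bool" where
  "down_closed K \<longleftrightarrow> (\<forall>\<sigma>\<in>K. \<forall>\<tau>. \<tau> \<subseteq> \<sigma> \<longrightarrow> \<tau> \<in> K)"

lemma simplicial_boundary_0: "simplicial_boundary 0 = 0"
  by (simp add: simplicial_boundary_def)

lemma simplicial_boundary_add:
  "simplicial_boundary (a + b) = simplicial_boundary a + simplicial_boundary b"
  by (simp add: simplicial_boundary_def frag_extend_add)

lemma simplicial_boundary_diff:
  "simplicial_boundary (a - b) = simplicial_boundary a - simplicial_boundary b"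
  by (simp add: simplicial_boundary_def frag_extend_diff)

lemma face_sign_cases: "face_sign \<sigma> v = 1 \<or> face_sign \<sigma> v = - 1"
  by (simp add: face_sign_def minus_one_power_iff)

lemma face_sign_square [simp]: "face_sign \<sigma> v * face_sign \<sigma> v = 1"
  by (simp add: face_sign_def flip: power_add mult_2)

lemma keys_simplicial_boundary:
  assumes "down_closed K" and "Poly_Mapping.keys c \<subseteq> faces K (Suc n)"
  shows "Poly_Mapping.keys (simplicial_boundary c) \<subseteq> faces K n"
proof -
  have "Poly_Mapping.keys (\<Sum>v\<in>\<sigma>. frag_cmul (face_sign \<sigma> v) (frag_of (\<sigma> - {v}))) \<subseteq> faces K n"
    if "\<sigma> \<in> faces K (Suc n)" for \<sigma>
  proof -
    have "\<sigma> - {v} \<in> faces K n" if "v \<in> \<sigma>" for v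
      using that \<open>\<sigma> \<in> _\<close> assms(1) by (auto simp: faces_def down_closed_def)
    then show ?thesis
      by (intro order.trans[OF keys_sum]) (auto simp: keys_frag_of)
  qed
  with assms(2) show ?thesis
    unfolding simplicial_boundary_def by (intro order.trans[OF keys_frag_extend]) blast
qed

text \<open>A group modulo itself is trivial, so the point is that boundaries and cycles coincide.
  For \<open>p < -1\<close> no \<open>n\<close> meets the second premise, and that range is settled
  separately.\<close>

lemma trivial_reduced_homology:
  assumes "down_closed K"
    and "\<And>n. int n = p + 1 \<Longrightarrow> exact_at K n"
  shows "trivial_group (reduced_simplicial_homology_group K p)"
proof -
  let ?C = "simplicial_chain_group K p" and ?Z = "simplicial_cycles K p"
  let ?G = "subgroup_generated ?C ?Z"
  interpret C: group ?C
    by (simp add: simplicial_chain_group_def)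
  have faces: "{\<sigma> \<in> K. finite \<sigma> \<and> int (card \<sigma>) = p + 1} = faces K n" if "int n = p + 1" for n p
    using that by (auto simp: faces_def)
  have sub: "subgroup ?Z ?C"
  proof (rule C.subgroupI)
    show "?Z \<noteq> {}"
      by (auto simp: simplicial_cycles_def simplicial_chain_group_def simplicial_boundary_0
          intro!: exI[of _ 0])
    fix a assume a: "a \<in> ?Z"
    then show "inv\<^bsub>?C\<^esub> a \<in> ?Z"
      by (auto simp: simplicial_cycles_def simplicial_chain_group_def simplicial_boundary_def
          frag_extend_minus)
    fix b assume "b \<in> ?Z"
    with a show "a \<otimes>\<^bsub>?C\<^esub> b \<in> ?Z"
      by (auto simp: simplicial_cycles_def simplicial_chain_group_def simplicial_boundary_add
          dest!: subsetD[OF keys_add])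
  qed (auto simp: simplicial_cycles_def)
  have carr: "carrier ?G = ?Z"
    using sub by (rule subgroup.carrier_subgroup_generated_subgroup)
  have "simplicial_boundaries K p = ?Z"
  proof (cases "\<exists>n. int n = p + 1")
    case True
    then obtain n where n: "int n = p + 1" by blast
    then have n': "int (Suc n) = p + 1 + 1" by simp
    have C: "carrier ?C = {c. Poly_Mapping.keys c \<subseteq> faces K n}"
      "carrier (simplicial_chain_group K (p + 1)) = {c. Poly_Mapping.keys c \<subseteq> faces K (Suc n)}"
      unfolding simplicial_chain_group_def faces[OF n] faces[OF n'] by auto
    have "simplicial_boundary (simplicial_boundary d) = 0"
      if "Poly_Mapping.keys d \<subseteq> faces K (Suc n)" for d
      using that by (intro simplicial_boundary_boundary) (auto simp: faces_def)
    with keys_simplicial_boundary[OF assms(1), of _ n] assms(2)[OF n] show ?thesis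
      unfolding simplicial_boundaries_def simplicial_cycles_def C exact_at_def by blast
  next
    case False
    then have p: "p + 1 < 0"
      by (metis not_less nonneg_int_cases)
    have C: "carrier ?C = {0}"
      using p by (auto simp: simplicial_chain_group_def subset_iff)
    have "0 \<in> carrier (simplicial_chain_group K (p + 1))"
      by (simp add: simplicial_chain_group_def)
    \<comment> \<open>For \<open>p = -2\<close> the degree \<open>p + 1\<close> is
      \<open>-1\<close>: its chain group can contain multiples of the empty simplex, whose boundary
      is an empty sum.\<close>
    moreover have "simplicial_boundary c = 0"
      if "c \<in> carrier (simplicial_chain_group K (p + 1))" for c
      unfolding simplicial_boundary_def
    proof (rule frag_extend_eq_0)
      fix \<sigma> assume "\<sigma> \<in> Poly_Mapping.keys c"
      with that have "finite \<sigma>" "int (card \<sigma>) = p + 2"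
        by (auto simp: simplicial_chain_group_def)
      with p have "card \<sigma> = 0" by linarith
      with \<open>finite \<sigma>\<close> have "\<sigma> = {}" by simp
      then show "(\<Sum>v\<in>\<sigma>. frag_cmul (face_sign \<sigma> v) (frag_of (\<sigma> - {v}))) = 0"
        by simp
    qed
    ultimately show ?thesis
      unfolding simplicial_boundaries_def simplicial_cycles_def C
      by (auto simp: simplicial_boundary_0 image_iff)
  qed
  moreover interpret G: group ?G
    by (rule C.group_subgroup_generated)
  have "trivial_group (?G Mod carrier ?G)"
  proof -
    have "carrier (?G Mod carrier ?G) = {\<one>\<^bsub>?G Mod carrier ?G\<^esub>}"
      by (auto simp: FactGroup_def RCOSETS_def G.coset_join2 G.subgroup_self intro!: G.one_closed)
    then show ?thesis
      using normal.factorgroup_is_group[OF G.normal_self] by (simp add: trivial_group_def)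
  qed
  ultimately show ?thesis
    unfolding reduced_simplicial_homology_group_def carr by simp
qed

section \<open>Removing the simplices that contain a fixed set\<close>

text \<open>For finite disjoint \<open>e\<close> and \<open>\<tau>\<close> this is the parity of the
  pairs \<open>u\<close> in \<open>e\<close>, \<open>v\<close> in \<open>\<tau>\<close> with
  \<open>u\<close> below \<open>v\<close>: the sign of the shuffle that sorts \<open>\<tau>\<close>
  followed by \<open>e\<close>. With \<open>e\<close> placed last, positions inside
  \<open>\<tau>\<close> do not shift.\<close>

definition link_sign :: "'a set \<Rightarrow> 'a set \<Rightarrow> int" where
  "link_sign e \<tau> = (\<Prod>v\<in>\<tau>. (- 1) ^ card {u \<in> e. u \<noteq> v \<and> (u, v) \<in> vertex_order})"

text \<open>The signs make \<open>link_map e\<close> a chain map, without a factor depending on the degree.\<close>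

definition link_map :: "'a set \<Rightarrow> ('a set \<Rightarrow>\<^sub>0 int) \<Rightarrow> ('a set \<Rightarrow>\<^sub>0 int)" where
  "link_map e = frag_extend
     (\<lambda>\<sigma>. if e \<subseteq> \<sigma> then frag_cmul (link_sign e (\<sigma> - e)) (frag_of (\<sigma> - e)) else 0)"

text \<open>A section of \<open>link_map e\<close> on simplices disjoint from \<open>e\<close>. For
  nonempty \<open>e\<close> it is not a chain map in general, as the boundary of
  \<open>e \<union> \<tau>\<close> also has faces that miss a vertex of \<open>e\<close>.\<close>

definition join_map :: "'a set \<Rightarrow> ('a set \<Rightarrow>\<^sub>0 int) \<Rightarrow> ('a set \<Rightarrow>\<^sub>0 int)" where
  "join_map e = frag_extend (\<lambda>\<tau>. frag_cmul (link_sign e \<tau>) (frag_of (e \<union> \<tau>)))"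

lemma link_sign_square [simp]: "link_sign e \<tau> * link_sign e \<tau> = 1"
  by (simp add: link_sign_def flip: prod.distrib power_add mult_2)

text \<open>The vertices of \<open>\<sigma>\<close> below \<open>v\<close> split into those in
  \<open>e\<close> and those outside; the first count is exactly the factor that \<open>v\<close>
  contributes to \<open>link_sign\<close>.\<close>

lemma link_sign_face:
  assumes "finite \<sigma>" "e \<subseteq> \<sigma>" "v \<in> \<sigma> - e"
  shows "face_sign \<sigma> v * link_sign e (\<sigma> - e - {v}) = link_sign e (\<sigma> - e) * face_sign (\<sigma> - e) v"
proof -
  let ?k = "card {u \<in> e. u \<noteq> v \<and> (u, v) \<in> vertex_order}"
  have "{u \<in> \<sigma>. u \<noteq> v \<and> (u, v) \<in> vertex_order}
      = {u \<in> e. u \<noteq> v \<and> (u, v) \<in> vertex_order} \<union> {u \<in> \<sigma> - e. u \<noteq> v \<and> (u, v) \<in> vertex_order}"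
    using assms by auto
  also have "card \<dots> = ?k + card {u \<in> \<sigma> - e. u \<noteq> v \<and> (u, v) \<in> vertex_order}"
    using assms by (intro card_Un_disjoint) (auto intro: finite_subset)
  finally have "face_sign \<sigma> v = (- 1) ^ ?k * face_sign (\<sigma> - e) v"
    by (simp add: face_sign_def power_add)
  moreover have "link_sign e (\<sigma> - e) = (- 1) ^ ?k * link_sign e (\<sigma> - e - {v})"
    using assms unfolding link_sign_def by (intro prod.remove) auto
  ultimately show ?thesis
    by simp
qed

text \<open>A face that drops a vertex of \<open>e\<close> no longer contains \<open>e\<close> and
  is killed by \<open>link_map e\<close>; the remaining faces match by
  \<open>link_sign_face\<close>.\<close>

lemma link_map_boundary:
  assumes "\<And>\<sigma>. \<sigma> \<in> Poly_Mapping.keys c \<Longrightarrow> finite \<sigma>"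
  shows "link_map e (simplicial_boundary c) = simplicial_boundary (link_map e c)"
proof -
  have single: "link_map e (simplicial_boundary (frag_of \<sigma>))
      = simplicial_boundary (link_map e (frag_of \<sigma>))" if fin: "finite \<sigma>" for \<sigma>
  proof (cases "e \<subseteq> \<sigma>")
    case True
    let ?f = "\<lambda>v. frag_cmul (face_sign \<sigma> v) (if e \<subseteq> \<sigma> - {v}
        then frag_cmul (link_sign e (\<sigma> - {v} - e)) (frag_of (\<sigma> - {v} - e)) else 0)"
    have "link_map e (simplicial_boundary (frag_of \<sigma>)) = (\<Sum>v\<in>\<sigma>. ?f v)"
      by (simp add: simplicial_boundary_def link_map_def frag_extend_sum[OF fin]
          frag_extend_cmul o_def)
    also have "\<dots> = (\<Sum>v\<in>\<sigma> - e. ?f v)"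
      using fin True by (intro sum.mono_neutral_right) auto
    also have "\<dots> = (\<Sum>v\<in>\<sigma> - e. frag_cmul (link_sign e (\<sigma> - e))
        (frag_cmul (face_sign (\<sigma> - e) v) (frag_of (\<sigma> - e - {v}))))"
    proof (rule sum.cong)
      fix v assume v: "v \<in> \<sigma> - e"
      have "\<sigma> - {v} - e = \<sigma> - e - {v}" by blast
      then show "?f v = frag_cmul (link_sign e (\<sigma> - e))
          (frag_cmul (face_sign (\<sigma> - e) v) (frag_of (\<sigma> - e - {v})))"
        using v True link_sign_face[OF fin True v] by auto
    qed simp
    also have "\<dots> = simplicial_boundary (link_map e (frag_of \<sigma>))"
      using True by (simp add: link_map_def simplicial_boundary_def frag_extend_cmul frag_cmul_sum)
    finally show ?thesis .
  next
    case False
    then have "\<not> e \<subseteq> \<sigma> - {v}" for v by blast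
    with False show ?thesis
      by (simp add: simplicial_boundary_def link_map_def frag_extend_sum[OF fin]
          frag_extend_cmul o_def)
  qed
  have "Poly_Mapping.keys c \<subseteq> {\<sigma>. finite \<sigma>}"
    using assms by blast
  then show ?thesis
  proof (induction c rule: frag_induction)
    case (diff a b)
    then show ?case by (simp add: simplicial_boundary_diff link_map_def frag_extend_diff)
  qed (simp_all add: single, simp add: simplicial_boundary_def link_map_def)
qed

lemma link_map_join_map:
  assumes "\<And>\<tau>. \<tau> \<in> Poly_Mapping.keys c \<Longrightarrow> \<tau> \<inter> e = {}"
  shows "link_map e (join_map e c) = c"
proof -
  have "Poly_Mapping.keys c \<subseteq> {\<tau>. \<tau> \<inter> e = {}}"
    using assms by blast
  then show ?thesis
  proof (induction c rule: frag_induction)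
    case (one \<tau>)
    then have "e \<union> \<tau> - e = \<tau>" by blast
    then show ?case by (simp add: link_map_def join_map_def frag_extend_cmul)
  qed (auto simp: link_map_def join_map_def frag_extend_diff)
qed

text \<open>Since \<open>link_sign\<close> is a unit, a chain killed by \<open>link_map e\<close>
  has coefficient zero at every simplex containing \<open>e\<close>.\<close>

lemma lookup_link_map:
  assumes "\<tau> \<inter> e = {}"
  shows "Poly_Mapping.lookup (link_map e c) \<tau> = link_sign e \<tau> * Poly_Mapping.lookup c (e \<union> \<tau>)"
proof -
  have "Poly_Mapping.keys c \<subseteq> UNIV" by simp
  then show ?thesis
  proof (induction c rule: frag_induction)
    case (one \<sigma>)
    have "e \<subseteq> \<sigma> \<Longrightarrow> \<sigma> - e = \<tau> \<longleftrightarrow> \<sigma> = e \<union> \<tau>" using assms by blast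
    then show ?case by (auto simp: link_map_def)
  next
    case (diff a b)
    then show ?case
      by (simp add: link_map_def frag_extend_diff lookup_minus right_diff_distrib)
  qed (simp add: link_map_def)
qed

text \<open>A chain-level form of the long exact sequence of a pair. A cycle off \<open>e\<close>
  bounds some \<open>d\<close> in \<open>K\<close>; the part of \<open>d\<close> that contains
  \<open>e\<close> yields a cycle in the link, and a filling of that cycle, joined with
  \<open>e\<close>, corrects \<open>d\<close>. Simplices of \<open>d\<close> have
  \<open>n + 1\<close> vertices, so \<open>e\<close> leaves \<open>m\<close> of them for the
  link.\<close>

lemma exact_at_delete:
  assumes K: "down_closed K" and e: "finite e"
    and ex: "exact_at K n"
    and link: "\<And>m. m + card e = Suc n \<Longrightarrow> exact_at {\<tau>. \<tau> \<inter> e = {} \<and> e \<union> \<tau> \<in> K} m"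
  shows "exact_at {\<sigma> \<in> K. \<not> e \<subseteq> \<sigma>} n"
  unfolding exact_at_def
proof (intro allI impI, elim conjE)
  let ?K = "{\<sigma> \<in> K. \<not> e \<subseteq> \<sigma>}" and ?L = "{\<tau>. \<tau> \<inter> e = {} \<and> e \<union> \<tau> \<in> K}"
  fix c assume c: "Poly_Mapping.keys c \<subseteq> faces ?K n" "simplicial_boundary c = 0"
  then have "Poly_Mapping.keys c \<subseteq> faces K n"
    by (auto simp: faces_def)
  with ex c(2) obtain d where d: "Poly_Mapping.keys d \<subseteq> faces K (Suc n)"
    "simplicial_boundary d = c"
    unfolding exact_at_def by blast
  show "\<exists>d. Poly_Mapping.keys d \<subseteq> faces ?K (Suc n) \<and> simplicial_boundary d = c"
  proof (cases "card e \<le> Suc n")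
    case False
    then have "faces K (Suc n) \<subseteq> faces ?K (Suc n)"
      by (auto simp: faces_def dest: card_mono)
    with d show ?thesis by blast
  next
    case True
    define m where "m = Suc n - card e"
    have m: "m + card e = Suc n" using True by (simp add: m_def)
    let ?t = "link_map e d"
    have "Poly_Mapping.keys ?t \<subseteq> faces ?L m"
    proof -
      have "\<sigma> - e \<in> faces ?L m" if "\<sigma> \<in> faces K (Suc n)" "e \<subseteq> \<sigma>" for \<sigma>
      proof -
        have "e \<union> (\<sigma> - e) = \<sigma>" using that by blast
        moreover have "card (\<sigma> - e) = m"
          using that e by (simp add: card_Diff_subset faces_def m_def)
        ultimately show ?thesis
          using that by (auto simp: faces_def)
      qed
      then show ?thesis
        unfolding link_map_def using d(1)
        by (intro order.trans[OF keys_frag_extend])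
          (auto simp: keys_frag_of split: if_splits)
    qed
    moreover have "simplicial_boundary ?t = link_map e c"
      using d by (subst link_map_boundary[symmetric]) (auto simp: faces_def)
    \<comment> \<open>No simplex of \<open>c\<close> contains \<open>e\<close>; hence
      \<open>?t\<close> is a cycle.\<close>
    moreover have "link_map e c = 0"
      unfolding link_map_def using c(1) by (intro frag_extend_eq_0) (auto simp: faces_def)
    ultimately obtain s where s: "Poly_Mapping.keys s \<subseteq> faces ?L (Suc m)"
      "simplicial_boundary s = ?t"
      using link[OF m] unfolding exact_at_def by auto
    let ?j = "join_map e s"
    have j: "Poly_Mapping.keys ?j \<subseteq> faces K (Suc (Suc n))"
    proof -
      have "e \<union> \<tau> \<in> faces K (Suc (Suc n))" if "\<tau> \<in> faces ?L (Suc m)" for \<tau>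
        using that e m by (auto simp: faces_def card_Un_disjoint Int_commute)
      then show ?thesis
        unfolding join_map_def using s(1)
        by (intro order.trans[OF keys_frag_extend]) (auto simp: keys_frag_of)
    qed
    then have fin: "\<sigma> \<in> Poly_Mapping.keys ?j \<Longrightarrow> finite \<sigma>" for \<sigma>
      by (auto simp: faces_def)
    \<comment> \<open>Subtracting a boundary keeps \<open>c\<close> as the boundary, while
      \<open>link_map e\<close> takes the same value on both terms, so everything containing
      \<open>e\<close> cancels.\<close>
    let ?d = "d - simplicial_boundary ?j"
    have keys: "Poly_Mapping.keys ?d \<subseteq> faces K (Suc n)"
      using keys_diff[of d "simplicial_boundary ?j"] keys_simplicial_boundary[OF K j] d(1) by blast
    have "link_map e (simplicial_boundary ?j) = simplicial_boundary (link_map e ?j)"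
      using fin by (rule link_map_boundary)
    also have "link_map e ?j = s"
      using s(1) by (intro link_map_join_map) (auto simp: faces_def)
    finally have d0: "link_map e ?d = 0"
      using s(2) by (simp add: link_map_def frag_extend_diff)
    have "Poly_Mapping.lookup ?d \<sigma> = 0" if "e \<subseteq> \<sigma>" for \<sigma>
    proof -
      have "(\<sigma> - e) \<inter> e = {}" "e \<union> (\<sigma> - e) = \<sigma>"
        using that by auto
      moreover have "link_sign e (\<sigma> - e) \<noteq> 0"
        using link_sign_square[of e "\<sigma> - e"] by (metis mult_zero_left zero_neq_one)
      ultimately show ?thesis
        using lookup_link_map[of "\<sigma> - e" e ?d] d0 by simp
    qed
    then have "Poly_Mapping.keys ?d \<subseteq> faces ?K (Suc n)"
      using keys by (auto simp: faces_def in_keys_iff)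
    moreover have "simplicial_boundary ?d = c"
      using d(2) simplicial_boundary_boundary[of ?j] fin by (simp add: simplicial_boundary_diff)
    ultimately show ?thesis by blast
  qed
qed

section \<open>Cones and the acyclicity of a full simplex\<close>

text \<open>The sign is that of the face \<open>\<sigma>\<close> in
  \<open>insert v \<sigma>\<close>, so that \<open>\<sigma>\<close> gets coefficient 1 in the
  boundary of its cone.\<close>

definition cone_map :: "'a \<Rightarrow> ('a set \<Rightarrow>\<^sub>0 int) \<Rightarrow> ('a set \<Rightarrow>\<^sub>0 int)" where
  "cone_map v = frag_extend (\<lambda>\<sigma>. if v \<in> \<sigma> then 0
     else frag_cmul (face_sign (insert v \<sigma>) v) (frag_of (insert v \<sigma>)))"

text \<open>If \<open>v\<close> is in \<open>\<sigma>\<close>, the cone on \<open>\<sigma>\<close>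
  vanishes and only the face opposite \<open>v\<close> has a nonzero cone, which returns
  \<open>\<sigma>\<close>. Otherwise the cones on the faces of \<open>\<sigma>\<close> cancel all of
  the boundary of the cone except \<open>\<sigma>\<close> itself.\<close>

lemma cone_map_homotopy:
  assumes "\<And>\<sigma>. \<sigma> \<in> Poly_Mapping.keys c \<Longrightarrow> finite \<sigma>"
  shows "simplicial_boundary (cone_map v c) + cone_map v (simplicial_boundary c) = c"
proof -
  have single: "simplicial_boundary (cone_map v (frag_of \<sigma>))
      + cone_map v (simplicial_boundary (frag_of \<sigma>)) = frag_of \<sigma>" if fin: "finite \<sigma>" for \<sigma>
  proof -
    let ?f = "\<lambda>u. frag_cmul (face_sign \<sigma> u) (if v \<in> \<sigma> - {u} then 0
        else frag_cmul (face_sign (insert v (\<sigma> - {u})) v) (frag_of (insert v (\<sigma> - {u}))))"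
    have eq: "cone_map v (simplicial_boundary (frag_of \<sigma>)) = (\<Sum>u\<in>\<sigma>. ?f u)"
      by (simp add: simplicial_boundary_def cone_map_def frag_extend_sum[OF fin]
          frag_extend_cmul o_def)
    show ?thesis
    proof (cases "v \<in> \<sigma>")
      case True
      have "(\<Sum>u\<in>\<sigma>. ?f u) = (\<Sum>u\<in>{v}. ?f u)"
        using True fin by (intro sum.mono_neutral_right) auto
      also have "\<dots> = frag_of \<sigma>"
        using True by (simp add: insert_absorb)
      finally show ?thesis
        using True unfolding eq by (simp add: cone_map_def simplicial_boundary_def)
    next
      case False
      let ?\<rho> = "insert v \<sigma>"
      have "simplicial_boundary (cone_map v (frag_of \<sigma>))
          = (\<Sum>u\<in>?\<rho>. frag_cmul (face_sign ?\<rho> v * face_sign ?\<rho> u) (frag_of (?\<rho> - {u})))"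
        using False by (simp add: cone_map_def simplicial_boundary_def frag_extend_cmul frag_cmul_sum
            del: sum.insert)
      also have "\<dots> = frag_of \<sigma>
          + (\<Sum>u\<in>\<sigma>. frag_cmul (face_sign ?\<rho> v * face_sign ?\<rho> u) (frag_of (?\<rho> - {u})))"
        using False fin by simp
      also have "(\<Sum>u\<in>\<sigma>. frag_cmul (face_sign ?\<rho> v * face_sign ?\<rho> u) (frag_of (?\<rho> - {u})))
          = (\<Sum>u\<in>\<sigma>. - ?f u)"
      proof (rule sum.cong)
        fix u assume u: "u \<in> \<sigma>"
        have uv: "u \<noteq> v" using u False by blast
        have 1: "?\<rho> - {v} = \<sigma>" "?\<rho> - {u} = insert v (\<sigma> - {u})"
          using False uv by auto
        have "face_sign ?\<rho> v * face_sign \<sigma> u = - (face_sign ?\<rho> u * face_sign (?\<rho> - {u}) v)"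
          using face_sign_swap[of ?\<rho> u v] u uv fin 1(1) by simp
        \<comment> \<open>Two factors of the swap identity change sides, since each sign is its own
          inverse.\<close>
        then have "face_sign ?\<rho> v * face_sign ?\<rho> u = - (face_sign \<sigma> u * face_sign (?\<rho> - {u}) v)"
          using face_sign_cases[of ?\<rho> v] face_sign_cases[of ?\<rho> u] face_sign_cases[of \<sigma> u]
          by (elim disjE) simp_all
        then show "frag_cmul (face_sign ?\<rho> v * face_sign ?\<rho> u) (frag_of (?\<rho> - {u})) = - ?f u"
          using False unfolding 1 by simp
      qed simp
      finally show ?thesis
        unfolding eq sum_negf by (simp only: add.assoc left_minus add_0_right)
    qed
  qed
  have "Poly_Mapping.keys c \<subseteq> {\<sigma>. finite \<sigma>}"
    using assms by blast
  then show ?thesis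
  proof (induction c rule: frag_induction)
    case (diff a b)
    have "simplicial_boundary (cone_map v (a - b)) + cone_map v (simplicial_boundary (a - b))
        = (simplicial_boundary (cone_map v a) + cone_map v (simplicial_boundary a))
        - (simplicial_boundary (cone_map v b) + cone_map v (simplicial_boundary b))"
      by (simp add: simplicial_boundary_diff cone_map_def frag_extend_diff)
    then show ?case using diff by simp
  qed (auto simp: single, simp add: simplicial_boundary_0 cone_map_def)
qed

lemma exact_at_Pow:
  assumes "v \<in> W"
  shows "exact_at (Pow W) n"
  unfolding exact_at_def
proof (intro allI impI, elim conjE)
  fix c assume c: "Poly_Mapping.keys c \<subseteq> faces (Pow W) n" "simplicial_boundary c = 0"
  have "insert v \<sigma> \<in> faces (Pow W) (Suc n)" if "\<sigma> \<in> Poly_Mapping.keys c" "v \<notin> \<sigma>" for \<sigma>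
    using that c(1) assms by (auto simp: faces_def)
  then have "Poly_Mapping.keys (cone_map v c) \<subseteq> faces (Pow W) (Suc n)"
    unfolding cone_map_def
    by (intro order.trans[OF keys_frag_extend]) (auto simp: keys_frag_of split: if_splits)
  moreover have "simplicial_boundary (cone_map v c) = c"
    using cone_map_homotopy[of c v] c by (auto simp: faces_def cone_map_def)
  ultimately show "\<exists>d. Poly_Mapping.keys d \<subseteq> faces (Pow W) (Suc n) \<and> simplicial_boundary d = c"
    by blast
qed



section \<open>Independence complexes of hypergraphs\<close>

text \<open>The void complex, lacking even the empty simplex. It arises when contracting an edge
  that contains another one, which leaves an empty edge.\<close>

lemma exact_at_empty: "exact_at {} n"
  by (auto simp: exact_at_def faces_def simplicial_boundary_0 intro!: exI[of _ 0])

definition independent_sets :: "'a set \<Rightarrow> 'a set set \<Rightarrow> 'a set set" where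
  "independent_sets V H = {\<sigma>. \<sigma> \<subseteq> V \<and> (\<forall>f\<in>H. \<not> f \<subseteq> \<sigma>)}"

lemma down_closed_independent_sets: "down_closed (independent_sets V H)"
  by (auto simp: down_closed_def independent_sets_def)

text \<open>Without an empty edge, the complex is the full simplex on the vertices not blocked by a
  one-vertex edge, and \<open>v\<close> serves as its apex.\<close>

lemma exact_at_independent_sets_singletons:
  assumes "\<And>f. f \<in> H \<Longrightarrow> finite f \<and> card f \<le> 1" and "v \<in> V" and "{v} \<notin> H"
  shows "exact_at (independent_sets V H) n"
proof (cases "{} \<in> H")
  case True
  then have "independent_sets V H = {}"
    by (auto simp: independent_sets_def)
  then show ?thesis by (simp add: exact_at_empty)
next
  case False
  have "\<exists>u. f = {u}" if "f \<in> H" for f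
    using assms(1)[OF that] False that by (metis card_1_singletonE card_0_eq le_antisym less_one linorder_not_le)
  then have "independent_sets V H = Pow {u \<in> V. {u} \<notin> H}"
    by (fastforce simp: independent_sets_def)
  then show ?thesis
    using assms by (simp add: exact_at_Pow[of v])
qed

text \<open>
  The parameter \<open>q\<close> bounds the cost of the first contraction; the contracted hypergraph may have
  edges of any size, so the induction hypothesis is used there with \<open>q = 1\<close>.
\<close>

lemma dominating_edges_of_not_exact:
  assumes "finite V" "finite H" "\<And>f. f \<in> H \<Longrightarrow> f \<subseteq> V"
    and "q \<ge> 1" "\<And>f. f \<in> H \<Longrightarrow> card f \<ge> 2 \<Longrightarrow> card f \<ge> q + 1"
    and "\<not> exact_at (independent_sets V H) n"
  shows "\<exists>E \<subseteq> H. (E = {} \<or> card E + q \<le> n + 1) \<and> (\<forall>e\<in>E. card e \<ge> 2) \<and>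
           (\<forall>v\<in>V. v \<in> \<Union>E \<or> (\<exists>f\<in>H. v \<in> f \<and> f \<subseteq> insert v (\<Union>E)))"
  using assms
proof (induction "card H" arbitrary: V H q n rule: less_induct)
  case less
  note fin = less.prems(1,2) and sub = less.prems(3) and q = less.prems(4,5)
  have finf: "finite f" if "f \<in> H" for f
    using sub[OF that] fin(1) by (rule finite_subset)
  show ?case
  proof (cases "\<exists>e\<in>H. card e \<ge> 2")
    case False
    then have "finite f \<and> card f \<le> 1" if "f \<in> H" for f
      using that finf not_less_eq_eq[of "card f" 1] by (auto simp: numeral_2_eq_2)
    \<comment> \<open>An unblocked vertex would make the complex exact. So the edge
      \<open>{v}\<close> serves as \<open>f\<close> for each \<open>v\<close>, with \<open>E\<close>
      empty.\<close>
    then have "\<forall>v\<in>V. {v} \<in> H"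
      using less.prems(6) exact_at_independent_sets_singletons by metis
    then show ?thesis
      by (intro exI[of _ "{}"]) auto
  next
    case True
    then obtain e where e: "e \<in> H" "card e \<ge> 2" by blast
    let ?H = "H - {e}" and ?L = "(\<lambda>f. f - e) ` (H - {e})"
    have smaller: "card ?H < card H"
      using e(1) fin(2) by (rule card_Diff1_less[rotated])
    have indep: "independent_sets V H = {\<sigma> \<in> independent_sets V ?H. \<not> e \<subseteq> \<sigma>}"
      using e(1) by (auto simp: independent_sets_def)
    have link: "{\<tau>. \<tau> \<inter> e = {} \<and> e \<union> \<tau> \<in> independent_sets V ?H} = independent_sets (V - e) ?L"
      using sub[OF e(1)] by (auto simp: independent_sets_def)
    \<comment> \<open>Contrapositive of \<open>exact_at_delete\<close> for the complex of
      \<open>?H\<close>: removing its simplices that contain \<open>e\<close> gives the complex of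
      \<open>H\<close>.\<close>
    consider "\<not> exact_at (independent_sets V ?H) n"
      | m where "m + card e = Suc n" "\<not> exact_at (independent_sets (V - e) ?L) m"
      using exact_at_delete[OF down_closed_independent_sets finf[OF e(1)], of V ?H n]
        less.prems(6) unfolding indep link by blast
    then show ?thesis
    proof cases
      case 1
      have "\<exists>E \<subseteq> ?H. (E = {} \<or> card E + q \<le> n + 1) \<and> (\<forall>e\<in>E. card e \<ge> 2) \<and>
           (\<forall>v\<in>V. v \<in> \<Union>E \<or> (\<exists>f\<in>?H. v \<in> f \<and> f \<subseteq> insert v (\<Union>E)))"
        by (rule less.hyps[OF smaller fin(1) _ _ q(1) _ 1]) (use fin sub q in auto)
      then obtain E where E: "E \<subseteq> ?H" "E = {} \<or> card E + q \<le> n + 1" "\<forall>e\<in>E. card e \<ge> 2"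
        and dom: "\<forall>v\<in>V. v \<in> \<Union>E \<or> (\<exists>f\<in>?H. v \<in> f \<and> f \<subseteq> insert v (\<Union>E))"
        by (elim exE conjE)
      from E(1) have "E \<subseteq> H"
        by (rule subset_trans) (rule Diff_subset)
      moreover from dom have "\<forall>v\<in>V. v \<in> \<Union>E \<or> (\<exists>f\<in>H. v \<in> f \<and> f \<subseteq> insert v (\<Union>E))"
        by (meson DiffD1)
      ultimately show ?thesis
        using E(2,3) by (intro exI[of _ E] conjI)
    next
      case (2 m)
      have "card ?L < card H"
        using card_image_le[of ?H "\<lambda>f. f - e"] fin(2) smaller by simp
      then have "\<exists>E \<subseteq> ?L. (E = {} \<or> card E + 1 \<le> m + 1) \<and> (\<forall>e\<in>E. card e \<ge> 2) \<and>
           (\<forall>v\<in>V - e. v \<in> \<Union>E \<or> (\<exists>f\<in>?L. v \<in> f \<and> f \<subseteq> insert v (\<Union>E)))"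
        by (rule less.hyps[OF _ _ _ _ _ _ 2(2)]) (use fin sub in auto)
      then obtain E where E: "E \<subseteq> ?L" "E = {} \<or> card E + 1 \<le> m + 1" "\<forall>e\<in>E. card e \<ge> 2"
        and dom: "\<forall>v\<in>V - e. v \<in> \<Union>E \<or> (\<exists>f\<in>?L. v \<in> f \<and> f \<subseteq> insert v (\<Union>E))"
        by (elim exE conjE)
      \<comment> \<open>Several edges may have the same contraction; one preimage is chosen for each
        member of \<open>E\<close>, so that the cardinality is preserved.\<close>
      from E(1) obtain F where F: "F \<subseteq> ?H" "inj_on (\<lambda>f. f - e) F" "E = (\<lambda>f. f - e) ` F"
        unfolding subset_image_inj by (elim exE conjE)
      have "card F = card E"
        using F by (simp add: card_image)
      moreover have finF: "finite F"
        using F(1) fin(2) by (auto intro: finite_subset)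
      ultimately have "card (insert e F) \<le> m + 1"
        using E(2) card_insert_le_m1[of "m+1" F e] by (cases "E = {}") auto
      \<comment> \<open>Here \<open>card e \<ge> q + 1\<close> gives \<open>m + q \<le> n\<close>:
        the first contraction pays for \<open>q\<close>, and \<open>e\<close> itself uses the slack
        1 in the bound on \<open>E\<close>.\<close>
      with 2(1) q(2)[OF e] have "card (insert e F) + q \<le> n + 1"
        by linarith
      moreover have "card f \<ge> 2" if "f \<in> F" for f
      proof -
        have "card (f - e) \<ge> 2"
          using E(3) F(3) that by simp
        moreover have "card (f - e) \<le> card f"
          using F(1) that finf by (intro card_mono) auto
        ultimately show ?thesis by linarith
      qed
      moreover have "v \<in> \<Union>(insert e F) \<or> (\<exists>f\<in>H. v \<in> f \<and> f \<subseteq> insert v (\<Union>(insert e F)))"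
        if "v \<in> V" for v
      proof (cases "v \<in> e")
        case False
        have EF: "\<Union>E \<subseteq> \<Union>F"
          using F(3) by blast
        have "v \<in> V - e"
          using that False by simp
        with dom have "v \<in> \<Union>E \<or> (\<exists>f\<in>?L. v \<in> f \<and> f \<subseteq> insert v (\<Union>E))"
          by (rule bspec)
        then show ?thesis
        proof
          assume "v \<in> \<Union>E"
          then show ?thesis using EF by blast
        next
          assume "\<exists>f\<in>?L. v \<in> f \<and> f \<subseteq> insert v (\<Union>E)"
          then obtain f where f: "f \<in> H" "v \<in> f" "f - e \<subseteq> insert v (\<Union>E)"
            by (elim bexE imageE conjE) force
          \<comment> \<open>Whatever contraction removed from \<open>f\<close> lies in
            \<open>e\<close>.\<close>
          have "f \<subseteq> insert v (\<Union>(insert e F))"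
            using f(3) EF by blast
          with f(1,2) show ?thesis by blast
        qed
      qed simp
      moreover have "insert e F \<subseteq> H"
        using e(1) F(1) by blast
      ultimately show ?thesis
        using e(2) by (intro exI[of _ "insert e F"] conjI) simp_all
    qed
  qed
qed

section \<open>Connected sets and domination in graphs\<close>

lemma arcs_ends_induce:
  "arcs_ends (G \<restriction> S) = {(u, v) \<in> arcs_ends G. u \<in> S \<and> v \<in> S}"
  by (auto simp: arcs_ends_conv)

context sym_digraph
begin

lemma symmetric_induce: "symmetric (G \<restriction> S)"
  using sym_arcs by (auto simp: symmetric_def arcs_ends_induce sym_def)

lemma strongly_connected_induce_singleton: "strongly_connected (G \<restriction> {v})"
proof -
  interpret S: wf_digraph "G \<restriction> {v}" by auto
  show ?thesis by (auto intro!: strongly_connectedI)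
qed

lemma strongly_connected_induce_insert:
  assumes "strongly_connected (G \<restriction> S)" "u \<in> S" "(u, v) \<in> arcs_ends G"
  shows "strongly_connected (G \<restriction> insert v S)"
proof -
  let ?T = "insert v S"
  interpret T: wf_digraph "G \<restriction> ?T" by auto
  have old: "x \<rightarrow>\<^sup>*\<^bsub>G \<restriction> ?T\<^esub> y" if "x \<in> S" "y \<in> S" for x y
    by (rule reachable_induce_ss[where S = S])
      (use assms(1) that in \<open>auto simp: strongly_connected_def\<close>)
  have uv: "u \<rightarrow>\<^sup>*\<^bsub>G \<restriction> ?T\<^esub> v"
    using assms by (intro T.reachable_adjI) (simp add: arcs_ends_induce)
  then have vu: "v \<rightarrow>\<^sup>*\<^bsub>G \<restriction> ?T\<^esub> u"
    by (rule symmetric_reachable[OF symmetric_induce])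
  have "x \<rightarrow>\<^sup>*\<^bsub>G \<restriction> ?T\<^esub> u" "u \<rightarrow>\<^sup>*\<^bsub>G \<restriction> ?T\<^esub> x" if "x \<in> ?T" for x
    using that old assms(2) uv vu by auto
  then show ?thesis
    by (intro strongly_connectedI) (simp, metis T.reachable_trans induce_subgraph_verts)
qed

text \<open>Otherwise \<open>S\<close> would be closed under the arcs inside \<open>C\<close>, and
  no vertex of \<open>C - S\<close> could be reached from it.\<close>

lemma strongly_connected_leaving_arc:
  assumes "strongly_connected (G \<restriction> C)" "S \<subset> C" "S \<noteq> {}"
  obtains u v where "u \<in> S" "v \<in> C - S" "(u, v) \<in> arcs_ends G"
proof (rule ccontr)
  assume "\<not> thesis"
  with that have closed: "v \<in> S" if "u \<in> S" "(u, v) \<in> arcs_ends (G \<restriction> C)" for u v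
    using that by (auto simp: arcs_ends_induce)
  obtain a b where a: "a \<in> S" and b: "b \<in> C - S"
    using assms by blast
  then have "a \<rightarrow>\<^sup>*\<^bsub>G \<restriction> C\<^esub> b"
    using assms by (auto simp: strongly_connected_def)
  then have "(a, b) \<in> (arcs_ends (G \<restriction> C))\<^sup>*"
    by (rule reachable_rtranclI)
  then have "b \<in> S"
    by (induction rule: rtrancl_induct) (use a closed in auto)
  with b show False by simp
qed

text \<open>Grow from a single vertex, adding the head of a leaving arc at each stage.\<close>

lemma strongly_connected_subset_card:
  assumes "strongly_connected (G \<restriction> C)" "finite C" "1 \<le> m" "m \<le> card C"
  obtains S where "S \<subseteq> C" "card S = m" "strongly_connected (G \<restriction> S)"
proof -
  have "\<exists>S \<subseteq> C. card S = m \<and> strongly_connected (G \<restriction> S)"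
    using assms(3,4)
  proof (induction m rule: dec_induct)
    case base
    obtain v where "v \<in> C"
      using assms(1) by (auto simp: strongly_connected_def)
    then show ?case
      by (intro exI[of _ "{v}"]) (simp add: strongly_connected_induce_singleton)
  next
    case (step m)
    then obtain S where S: "S \<subseteq> C" "card S = m" "strongly_connected (G \<restriction> S)"
      by auto
    have "S \<noteq> C"
      using S(2) step.prems by auto
    then have "S \<subset> C"
      using S(1) by blast
    moreover have "S \<noteq> {}"
      using S(2) step.hyps(1) by auto
    ultimately obtain u v where uv: "u \<in> S" "v \<in> C - S" "(u, v) \<in> arcs_ends G"
      using strongly_connected_leaving_arc[OF assms(1)] by blast
    then have "strongly_connected (G \<restriction> insert v S)"
      using S(3) strongly_connected_induce_insert by blast
    then show ?case
      using uv S finite_subset[OF S(1) assms(2)] by (intro exI[of _ "insert v S"]) auto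
  qed
  then show thesis using that by blast
qed

end

lemma graph_dist_le_length:
  assumes "wf_digraph G" "pre_digraph.awalk G u p v"
  shows "graph_dist G u v \<le> ereal (real (length p))"
proof -
  interpret wf_digraph G by fact
  have "awalk_cost (\<lambda>_. 1) p = real (length p)"
    by (induction p) auto
  with min_cost_le_walk_cost[OF assms(2), of "\<lambda>_. 1"] show ?thesis
    by (simp add: graph_dist_def)
qed

section \<open>From the independence complex to dominating families\<close>

context graph
begin

abbreviation connected_sets :: "nat \<Rightarrow> 'a set set" where
  "connected_sets m \<equiv> {f. f \<subseteq> verts G \<and> card f = m \<and> strongly_connected (G \<restriction> f)}"

text \<open>A connected set lies inside one component, and a component with more than
  \<open>r\<close> vertices contains a connected set of exactly \<open>r + 1\<close>.\<close>

lemma Ind_complex_eq_independent_sets: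
  "Ind_complex G r = independent_sets (verts G) (connected_sets (Suc r))"
proof -
  have eq: "(\<forall>C \<in> pre_digraph.sccs (G \<restriction> A). card (verts C) \<le> r) \<longleftrightarrow>
      (\<forall>f\<in>connected_sets (Suc r). \<not> f \<subseteq> A)" if A: "A \<subseteq> verts G" for A
  proof
    interpret A: wf_digraph "G \<restriction> A" ..
    assume r: "\<forall>C \<in> A.sccs. card (verts C) \<le> r"
    show "\<forall>f\<in>connected_sets (Suc r). \<not> f \<subseteq> A"
    proof (intro ballI notI)
      fix f assume f: "f \<in> connected_sets (Suc r)" "f \<subseteq> A"
      then obtain u where u: "u \<in> f"
        by (auto simp: strongly_connected_def)
      have "x \<rightarrow>\<^sup>*\<^bsub>G \<restriction> A\<^esub> y" if "x \<in> f" "y \<in> f" for x y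
        by (rule reachable_induce_ss[OF _ f(2)])
          (use f that in \<open>simp add: strongly_connected_def\<close>)
      then have "f \<subseteq> A.scc_of u"
        using u by (auto simp: A.scc_of_def)
      moreover have "A.scc_of u \<in> verts ` A.sccs"
        using u f(2) A.scc_of_in_sccs_verts[of u] by (auto simp: A.sccs_verts_conv)
      then obtain C where C: "C \<in> A.sccs" "A.scc_of u = verts C"
        by blast
      moreover have "verts C \<subseteq> A"
        using subgraph_imp_subverts[OF induced_imp_subgraph[OF A.in_sccs_imp_induced[OF C(1)]]]
        by simp
      then have "finite (verts C)"
        using A finite_verts by (meson finite_subset)
      ultimately have "card f \<le> r"
        using r card_mono[of "verts C" f] by (metis order_trans)
      with f(1) show False by simp
    qed
  next
    assume no: "\<forall>f\<in>connected_sets (Suc r). \<not> f \<subseteq> A"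
    show "\<forall>C \<in> pre_digraph.sccs (G \<restriction> A). card (verts C) \<le> r"
    proof (intro ballI, rule ccontr)
      fix C assume C: "C \<in> pre_digraph.sccs (G \<restriction> A)" and "\<not> card (verts C) \<le> r"
      then have card: "Suc r \<le> card (verts C)" by simp
      from C have sub: "subgraph C (G \<restriction> A)" and sc: "strongly_connected C"
        by (simp_all add: pre_digraph.sccs_def induced_imp_subgraph)
      have CA: "verts C \<subseteq> A"
        using subgraph_imp_subverts[OF sub] by simp
      have "subgraph C G"
        using subgraph_trans[OF sub] A by (simp add: subgraph_induce_subgraphI)
      then have "strongly_connected (G \<restriction> verts C)"
        using sc by (rule strongly_connected_imp_induce_subgraph_strongly_connected)
      moreover have "finite (verts C)"
        using CA A finite_verts by (meson finite_subset)
      ultimately obtain f where "f \<subseteq> verts C" "card f = Suc r" "strongly_connected (G \<restriction> f)"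
        using strongly_connected_subset_card[of "verts C" "Suc r"] card
        by (metis le_add1 plus_1_eq_Suc)
      with no CA A show False by blast
    qed
  qed
  show ?thesis
    unfolding Ind_complex_def r_independent_def independent_sets_def
    by (rule Collect_cong) (rule conj_cong[OF refl eq])
qed

text \<open>A common source for both domination numbers, phrased with vertex sets and adjacency in
  place of subgraphs and distances. Strong connectedness also makes the members nonempty, so
  representatives can be chosen.\<close>

definition dominating_sets :: "nat \<Rightarrow> 'a set set \<Rightarrow> bool" where
  "dominating_sets r P \<longleftrightarrow> finite P \<and>
     (\<forall>S\<in>P. S \<subseteq> verts G \<and> card S \<le> r \<and> strongly_connected (G \<restriction> S)) \<and>
     (\<forall>v\<in>verts G. \<exists>S\<in>P. \<exists>u\<in>S. v = u \<or> (v, u) \<in> arcs_ends G)"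

text \<open>The hypergraph lemma with \<open>q = r\<close> gives at most \<open>k\<close> connected
  sets of \<open>r + 1\<close> vertices. Each splits into a connected \<open>r\<close>-set and one
  further vertex, whence the factor 2.\<close>

lemma dominating_sets_of_not_exact:
  assumes "r \<ge> 1" "n + 1 \<le> k + r" "\<not> exact_at (Ind_complex G r) n"
  shows "\<exists>P. dominating_sets r P \<and> card P \<le> 2 * k"
proof -
  let ?H = "connected_sets (Suc r)"
  have "finite ?H"
    by (rule finite_subset[of _ "Pow (verts G)"]) auto
  then have "\<exists>E \<subseteq> ?H. (E = {} \<or> card E + r \<le> n + 1) \<and> (\<forall>e\<in>E. card e \<ge> 2) \<and>
      (\<forall>v\<in>verts G. v \<in> \<Union>E \<or> (\<exists>f\<in>?H. v \<in> f \<and> f \<subseteq> insert v (\<Union>E)))"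
    using assms by (intro dominating_edges_of_not_exact) (auto simp: Ind_complex_eq_independent_sets)
  then obtain E where E: "E \<subseteq> ?H" "E = {} \<or> card E + r \<le> n + 1"
    and dom: "\<forall>v\<in>verts G. v \<in> \<Union>E \<or> (\<exists>f\<in>?H. v \<in> f \<and> f \<subseteq> insert v (\<Union>E))"
    by (elim exE conjE)
  have finE: "finite E"
    using E(1) \<open>finite ?H\<close> by (rule finite_subset)
  have "card E \<le> k"
    using E(2) assms(2) by auto
  have "\<exists>S v. e = insert v S \<and> card S = r \<and> strongly_connected (G \<restriction> S)" if "e \<in> E" for e
  proof -
    have e: "card e = Suc r" "strongly_connected (G \<restriction> e)" "finite e"
      using that E(1) finite_subset[OF _ finite_verts] by auto
    then obtain S where S: "S \<subseteq> e" "card S = r" "strongly_connected (G \<restriction> S)"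
      using strongly_connected_subset_card[of e r] assms(1) by auto
    then have "card (e - S) = 1"
      using e by (simp add: card_Diff_subset finite_subset)
    then obtain v where "e - S = {v}"
      by (rule card_1_singletonE)
    then have "e = insert v S"
      using S(1) by blast
    with S show ?thesis by blast
  qed
  then obtain S x where Sx: "\<And>e. e \<in> E \<Longrightarrow>
      e = insert (x e) (S e) \<and> card (S e) = r \<and> strongly_connected (G \<restriction> S e)"
    by metis
  let ?P = "S ` E \<union> (\<lambda>e. {x e}) ` E"
  have "card ?P \<le> card (S ` E) + card ((\<lambda>e. {x e}) ` E)"
    by (rule card_Un_le)
  also have "\<dots> \<le> card E + card E"
    using finE by (intro add_mono card_image_le)
  also have "\<dots> \<le> 2 * k"
    using \<open>card E \<le> k\<close> by simp
  finally have "card ?P \<le> 2 * k" .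
  moreover have "dominating_sets r ?P"
    unfolding dominating_sets_def
  proof (intro conjI ballI)
    show "finite ?P" using finE by simp
  next
    fix T assume "T \<in> ?P"
    then obtain e where e: "e \<in> E" "T = S e \<or> T = {x e}" by blast
    then have "e \<subseteq> verts G" using E(1) by blast
    then show "T \<subseteq> verts G" "card T \<le> r" "strongly_connected (G \<restriction> T)"
      using e Sx[OF e(1)] assms(1) strongly_connected_induce_singleton by auto
  next
    have U: "\<exists>T\<in>?P. u \<in> T" if "u \<in> \<Union>E" for u
    proof -
      from that obtain e where "e \<in> E" "u \<in> e" by blast
      then show ?thesis using Sx[of e] by blast
    qed
    fix v assume "v \<in> verts G"
    with dom have "v \<in> \<Union>E \<or> (\<exists>f\<in>?H. v \<in> f \<and> f \<subseteq> insert v (\<Union>E))"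
      by (rule bspec)
    then show "\<exists>T\<in>?P. \<exists>u\<in>T. v = u \<or> (v, u) \<in> arcs_ends G"
    proof
      assume "v \<in> \<Union>E"
      then obtain T where "T \<in> ?P" "v \<in> T"
        by (rule bexE[OF U])
      then show ?thesis by (intro bexI[of _ T] bexI[of _ v]) simp_all
    next
      assume "\<exists>f\<in>?H. v \<in> f \<and> f \<subseteq> insert v (\<Union>E)"
      then obtain f where f: "f \<in> ?H" "v \<in> f" "f \<subseteq> insert v (\<Union>E)"
        by (elim bexE conjE)
      \<comment> \<open>As \<open>f\<close> has at least two vertices and is connected,
        \<open>v\<close> has a neighbour in \<open>f\<close>; that neighbour must lie in
        \<open>\<Union>E\<close>.\<close>
      have "f \<noteq> {v}"
        using f(1) assms(1) by auto
      then have "{v} \<subset> f" using f(2) by blast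
      then obtain u where "u \<in> f - {v}" "(v, u) \<in> arcs_ends G"
        using f(1) by (elim strongly_connected_leaving_arc[of f "{v}", rotated]) simp_all
      moreover from this f(3) have "u \<in> \<Union>E" by blast
      then obtain T where "T \<in> ?P" "u \<in> T"
        by (rule bexE[OF U])
      ultimately show ?thesis by (intro bexI[of _ T] bexI[of _ u]) simp_all
    qed
  qed
  ultimately show ?thesis by blast
qed

section \<open>Bounds on the two domination numbers\<close>

lemma set_domination_number_le:
  assumes "dominating_sets r P"
  shows "set_domination_number G r \<le> card P"
proof -
  let ?S = "(\<lambda>S. G \<restriction> S) ` P"
  have P: "finite P" "\<And>S. S \<in> P \<Longrightarrow> S \<subseteq> verts G \<and> card S \<le> r \<and> strongly_connected (G \<restriction> S)"
    "\<And>v. v \<in> verts G \<Longrightarrow> \<exists>S\<in>P. \<exists>u\<in>S. v = u \<or> (v, u) \<in> arcs_ends G"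
    using assms by (auto simp: dominating_sets_def)
  have "dominating_collection G r ?S"
    unfolding dominating_collection_def
  proof (intro conjI ballI)
    fix T assume "T \<in> ?S"
    then obtain S where S: "S \<in> P" "T = G \<restriction> S" by blast
    interpret S: wf_digraph "G \<restriction> S" by auto
    show "subgraph T G" "symmetric T" "card (verts T) \<le> r"
      using P(2)[OF S(1)] S(2) symmetric_induce by (auto simp: subgraph_induce_subgraphI)
    show "Digraph_Component.connected T"
      using P(2)[OF S(1)] S(2) S.reachable_mk_symmetricI
      by (auto simp: Digraph_Component.connected_def strongly_connected_def)
  next
    fix v assume v: "v \<in> verts G"
    then obtain S u where S: "S \<in> P" "u \<in> S" "v = u \<or> (v, u) \<in> arcs_ends G"
      using P(3) by blast
    have "\<exists>p. awalk v p u \<and> length p \<le> 1"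
    proof (cases "v = u")
      case True
      then show ?thesis using v by (intro exI[of _ "[]"]) (simp add: awalk_Nil_iff)
    next
      case False
      then obtain a where "a \<in> arcs G" "tail G a = v" "head G a = u"
        using S(3) by auto
      then show ?thesis by (intro exI[of _ "[a]"]) (auto simp: arc_implies_awalk)
    qed
    then obtain p where p: "awalk v p u" "length p \<le> 1" by blast
    have "graph_setdist G v S \<le> graph_dist G v u"
      unfolding graph_setdist_def using S(2) by (rule INF_lower)
    also have "\<dots> \<le> ereal (real (length p))"
      using graph_dist_le_length[OF wf_digraph_axioms p(1)] .
    also have "\<dots> \<le> 1"
      using p(2) by simp
    finally show "\<exists>S\<in>?S. graph_setdist G v (verts S) \<le> 1"
      using S(1) by auto
  qed
  then have "set_domination_number G r \<le> card ?S"
    unfolding set_domination_number_def using P(1) by (intro Least_le) blast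
  also have "\<dots> \<le> card P"
    using P(1) by (rule card_image_le)
  finally show ?thesis .
qed

text \<open>One representative per member suffices: at most one arc leads from \<open>v\<close> into
  \<open>S\<close>, and at most \<open>r - 1\<close> further arcs inside \<open>S\<close> lead to
  \<open>x S\<close>.\<close>

lemma distance_domination_number_le:
  assumes "dominating_sets r P"
  shows "distance_domination_number G r \<le> card P"
proof -
  have P: "finite P" "\<And>S. S \<in> P \<Longrightarrow> S \<subseteq> verts G \<and> card S \<le> r \<and> strongly_connected (G \<restriction> S)"
    "\<And>v. v \<in> verts G \<Longrightarrow> \<exists>S\<in>P. \<exists>u\<in>S. v = u \<or> (v, u) \<in> arcs_ends G"
    using assms by (auto simp: dominating_sets_def)
  have "\<exists>x. x \<in> S" if "S \<in> P" for S
    using P(2)[OF that] by (auto simp: strongly_connected_def)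
  then obtain x where x: "\<And>S. S \<in> P \<Longrightarrow> x S \<in> S"
    by metis
  have "distance_dominating G r (x ` P)"
    unfolding distance_dominating_def
  proof (intro conjI ballI)
    show "x ` P \<subseteq> verts G" using x P(2) by blast
  next
    fix v assume v: "v \<in> verts G - x ` P"
    then obtain S u where S: "S \<in> P" "u \<in> S" "v = u \<or> (v, u) \<in> arcs_ends G"
      using P(3) by blast
    have sub: "subgraph (G \<restriction> S) G"
      using P(2)[OF S(1)] by (simp add: subgraph_induce_subgraphI)
    interpret S: fin_digraph "G \<restriction> S"
      using sub by (rule fin_digraph_subgraph)
    have "u \<rightarrow>\<^sup>*\<^bsub>G \<restriction> S\<^esub> x S"
      using P(2)[OF S(1)] x[OF S(1)] S(2) by (simp add: strongly_connected_def)
    then obtain p where p: "S.apath u p (x S)"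
      using S.reachable_apath by blast
    \<comment> \<open>A path without repeated vertices in a set of at most \<open>r\<close> vertices
      has fewer than \<open>r\<close> arcs, which leaves room for the arc from \<open>v\<close> to
      \<open>u\<close>.\<close>
    have len: "length p < r"
      using S.length_apath_less[OF p] P(2)[OF S(1)] by simp
    have walk: "awalk u p (x S)"
      using subgraph_awalk_imp_awalk[OF S.awalkI_apath[OF p] sub] .
    have "\<exists>p. awalk v p (x S) \<and> length p \<le> r"
    proof (cases "v = u")
      case True
      with walk len show ?thesis by (intro exI[of _ p]) simp
    next
      case False
      then obtain a where "a \<in> arcs G" "tail G a = v" "head G a = u"
        using S(3) by auto
      with walk len show ?thesis
        by (intro exI[of _ "a # p"]) (auto simp: awalk_Cons_iff)
    qed
    then obtain p where p: "awalk v p (x S)" "length p \<le> r" by blast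
    have "graph_setdist G v (x ` P) \<le> graph_dist G v (x S)"
      unfolding graph_setdist_def using S(1) by (intro INF_lower) simp
    also have "\<dots> \<le> ereal (real (length p))"
      using graph_dist_le_length[OF wf_digraph_axioms p(1)] .
    also have "\<dots> \<le> ereal (real r)"
      using p(2) by simp
    finally show "graph_setdist G v (x ` P) \<le> ereal (real r)" .
  qed
  then have "distance_domination_number G r \<le> card (x ` P)"
    unfolding distance_domination_number_def by (intro Least_le) blast
  also have "\<dots> \<le> card P"
    using P(1) by (rule card_image_le)
  finally show ?thesis .
qed

lemma trivial_homology_Ind_complex:
  assumes "r \<ge> 1" "j \<le> int k + int r - 2"
    and "distance_domination_number G r > 2 * k \<or> set_domination_number G r > 2 * k"
  shows "trivial_group (reduced_simplicial_homology_group (Ind_complex G r) j)"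
proof (rule trivial_reduced_homology)
  show "down_closed (Ind_complex G r)"
    by (simp add: Ind_complex_eq_independent_sets down_closed_independent_sets)
  \<comment> \<open>Degree \<open>j\<close> corresponds to \<open>n = j + 1\<close> vertices, so the
    bound on \<open>j\<close> becomes \<open>n + 1 \<le> k + r\<close>.\<close>
  fix n assume "int n = j + 1"
  with assms(2) have n: "n + 1 \<le> k + r" by linarith
  show "exact_at (Ind_complex G r) n"
  proof (rule ccontr)
    assume "\<not> exact_at (Ind_complex G r) n"
    then obtain P where "dominating_sets r P" "card P \<le> 2 * k"
      using dominating_sets_of_not_exact[OF assms(1) n] by blast
    with assms(3) set_domination_number_le distance_domination_number_le show False
      by fastforce
  qed
qed

end

theorem theorem3p5:
  fixes G :: "('a, 'b) pre_digraph" and r k :: nat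
  assumes "graph G" and "r \<ge> 1"
  shows "(distance_domination_number G r > 2 * k \<longrightarrow>
           (\<forall>j :: int. j \<le> int k + int r - 2 \<longrightarrow>
             trivial_group (reduced_simplicial_homology_group (Ind_complex G r) j))) \<and>
         (set_domination_number G r > 2 * k \<longrightarrow>
           (\<forall>j :: int. j \<le> int k - 1 \<longrightarrow>
             trivial_group (reduced_simplicial_homology_group (Ind_complex G r) j)))"
proof -
  interpret graph G by fact
  \<comment> \<open>As \<open>r \<ge> 1\<close>, the degrees in (ii) are among those in (i), and the
    same lemma covers both.\<close>
  have "j \<le> int k + int r - 2" if "j \<le> int k - 1" for j
    using that assms(2) by linarith
  then show ?thesis
    using trivial_homology_Ind_complex[OF assms(2)] by blast
qed

end
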